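(* Let $N>1$ be an integer. The games $F_N^+$ and $FI_N^+$ are equivalent to the normal play of the game of Nim with one pile of size $N$. The games $FM_N^+$ and $FIM_N^+$ are equivalent to the mis\`ere play of the game of Nim with one pile of size $N$.
   Context: Coin games. There is a finite collection of identically-looking coins, exactly one of which is counterfeit; all real coins weigh the same. A weighing puts equal numbers of coins on the two pans of a balance scale; its outcome (balance, left lighter, right lighter) is seen by an Observer, who is a perfect reasoner and remembers all weighings. Two players, who know exactly which coin is counterfeit and whether it is heavier or lighter, alternate turns; a move is one weighing that gives the Observer some new information (i.e. strictly shrinks the set of possibilities, each consisting of a coin that could be counterfeit and whether it is lighter or heavier, that are consistent with everything the Observer has seen). Unknown coins with an extra coin. In the games $F_N^+$, $FI_N^+$, $FM_N^+$, $FIM_N^+$ there are $N$ unknown coins, one of which is counterfeit, and one extra coin known to everybody to be real (it may be used in weighings). Initially, from the Observer's viewpoint, each of the $N$ coins may be the counterfeit one and it may be either lighter or heavier than a real coin. A balanced weighing proves the coins on the scale real (they become excluded). An unbalanced weighing of unknown coins excludes the coins not on the scale; the non-excluded coins on the scale acquire a destiny: those on the lighter pan are destined to be lighter (if counterfeit, then lighter), those on the heavier pan are destined to be heavier. For destined coins, a later unbalanced weighing excludes lighter-destined coins on the heavier pan, heavier-destined coins on the lighter pan, and coins off the scale. Goals and end of game. In $F_N^+$ and $FM_N^+$ the Observer's goal is to find the counterfeit coin; in $FI_N^+$ and $FIM_N^+$ the goal is to find it and to identify whether it is lighter or heavier. $F_N^+$ and $FI_N^+$ are normal play: the game ends when the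 Observer reaches her goal, and the player who reveals the last necessary piece of information wins. $FM_N^+$ and $FIM_N^+$ are mis\`ere play: the player who reveals the full information (makes the Observer reach her goal) loses. Equivalence with Nim. A one-pile Nim game of size $n$ allows a player to replace the pile by any strictly smaller pile of size $\ge 0$; in normal play the player who moves to size $0$ wins, in mis\`ere play that player loses. A coin game is equivalent to one-pile Nim of size $n$ (with the same play convention) if one can assign a pile size to each of its reachable positions so that the starting position has pile size $n$, the positions in which the Observer has reached her goal are exactly those of pile size $0$, and from a position of pile size $m$ the legal moves lead to positions of each pile size $0,1,\dots,m-1$ and to no others. *)

theory Defs
  imports Main
begin

datatype convention = Normal | Misere

text \<open>Play stops at the positions satisfying \<open>over\<close>. The player whose move leads there wins
  under \<^const>\<open>Normal\<close> play and loses under \<^const>\<open>Misere\<close> play.\<close>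

record 'p game =
  start :: 'p
  move :: "'p \<Rightarrow> 'p \<Rightarrow> bool"
  over :: "'p \<Rightarrow> bool"
  play :: convention

definition reachable :: "('p, 'x) game_scheme \<Rightarrow> 'p \<Rightarrow> bool" where
  "reachable G p \<longleftrightarrow> (move G)\<^sup>*\<^sup>* (start G) p"

definition nim :: "convention \<Rightarrow> nat \<Rightarrow> nat game" where
  "nim c n = \<lparr>start = n, move = (\<lambda>m m'. m' < m), over = (\<lambda>m. m = 0), play = c\<rparr>"

definition equivalent_to_nim :: "'p game \<Rightarrow> convention \<Rightarrow> nat \<Rightarrow> bool" where
  "equivalent_to_nim G c n \<longleftrightarrow>
     play G = play (nim c n) \<and>
     (\<exists>size. size (start G) = start (nim c n) \<and>
        (\<forall>p. reachable G p \<longrightarrow>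
           (over G p \<longleftrightarrow> over (nim c n) (size p)) \<and>
           size ` {q. move G p q} = {m. move (nim c n) (size p) m}))"

lemma equivalent_to_nim_iff:
  "equivalent_to_nim G c n \<longleftrightarrow>
     play G = c \<and>
     (\<exists>size. size (start G) = n \<and>
        (\<forall>p. reachable G p \<longrightarrow> (over G p \<longleftrightarrow> size p = 0) \<and> size ` {q. move G p q} = {..<size p}))"
  by (simp add: equivalent_to_nim_def nim_def lessThan_def)

text \<open>The player to move wins, respectively loses, with best play. At a finished position
  the last move was made by the opponent.\<close>

inductive wins loses :: "('p, 'x) game_scheme \<Rightarrow> 'p \<Rightarrow> bool" for G where
  "over G p \<Longrightarrow> play G = Misere \<Longrightarrow> wins G p"
| "\<not> over G p \<Longrightarrow> move G p q \<Longrightarrow> loses G q \<Longrightarrow> wins G p"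
| "over G p \<Longrightarrow> play G = Normal \<Longrightarrow> loses G p"
| "\<not> over G p \<Longrightarrow> (\<And>q. move G p q \<Longrightarrow> wins G q) \<Longrightarrow> loses G p"

lemma equivalent_to_nim_same_winner:
  assumes "equivalent_to_nim G c n"
  shows "wins G (start G) \<longleftrightarrow> wins (nim c n) n" "loses G (start G) \<longleftrightarrow> loses (nim c n) n"
proof -
  from assms obtain size where pl: "play G = c" and st: "size (start G) = n"
    and ov: "\<And>p. reachable G p \<Longrightarrow> over G p \<longleftrightarrow> size p = 0"
    and mv: "\<And>p. reachable G p \<Longrightarrow> size ` {q. move G p q} = {..<size p}"
    unfolding equivalent_to_nim_iff by blast
  have nim_simps: "over (nim c n) m \<longleftrightarrow> m = 0" "move (nim c n) m k \<longleftrightarrow> k < m" "play (nim c n) = c"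
    for m k by (simp_all add: nim_def)
  have main: "reachable G p \<Longrightarrow> (wins G p \<longleftrightarrow> wins (nim c n) (size p)) \<and>
      (loses G p \<longleftrightarrow> loses (nim c n) (size p))" for p
  proof (induction "size p" arbitrary: p rule: less_induct)
    case less
    have IH: "(wins G q \<longleftrightarrow> wins (nim c n) (size q)) \<and> (loses G q \<longleftrightarrow> loses (nim c n) (size q))"
      if "move G p q" for q
    proof (rule less.hyps)
      show "size q < size p" using mv[OF less.prems] that by blast
      show "reachable G q" using less.prems that unfolding reachable_def by simp
    qed
    have to: "\<exists>q. move G p q \<and> size q = k" if "k < size p" for k
    proof -
      have "k \<in> size ` {q. move G p q}" using mv[OF less.prems] that by simp
      then show ?thesis by auto
    qed
    have fro: "size q < size p" if "move G p q" for q
      using mv[OF less.prems] that by blast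
    have "wins G p \<longleftrightarrow> (over G p \<and> c = Misere) \<or> (\<not> over G p \<and> (\<exists>q. move G p q \<and> loses G q))"
      by (subst wins.simps) (use pl in blast)
    moreover have "wins (nim c n) (size p) \<longleftrightarrow> (size p = 0 \<and> c = Misere) \<or>
        (size p \<noteq> 0 \<and> (\<exists>k<size p. loses (nim c n) k))"
      by (subst wins.simps) (auto simp: nim_simps)
    moreover have "loses G p \<longleftrightarrow> (over G p \<and> c = Normal) \<or> (\<not> over G p \<and> (\<forall>q. move G p q \<longrightarrow> wins G q))"
      by (subst loses.simps) (use pl in blast)
    moreover have "loses (nim c n) (size p) \<longleftrightarrow> (size p = 0 \<and> c = Normal) \<or>
        (size p \<noteq> 0 \<and> (\<forall>k<size p. wins (nim c n) k))"
      by (subst loses.simps) (auto simp: nim_simps)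
    ultimately show ?case using ov[OF less.prems] IH to fro by metis
  qed
  have "reachable G (start G)" by (simp add: reachable_def)
  from main[OF this] show "wins G (start G) \<longleftrightarrow> wins (nim c n) n"
    "loses G (start G) \<longleftrightarrow> loses (nim c n) n" by (simp_all add: st)
qed

datatype kind = Lighter | Heavier

text \<open>A possibility names the counterfeit coin and says how it differs from a real one.\<close>

type_synonym possibility = "nat \<times> kind"

datatype outcome = Balance | Left_Lighter | Right_Lighter

text \<open>Weights are measured relative to a real coin. Both pans carry equally many coins and only
  one coin is counterfeit, so the size of its deviation does not affect the outcome.\<close>

definition excess :: "possibility \<Rightarrow> nat \<Rightarrow> int" where
  "excess t x = (if x = fst t then (case snd t of Lighter \<Rightarrow> - 1 | Heavier \<Rightarrow> 1) else 0)"

definition weigh :: "possibility \<Rightarrow> nat set \<Rightarrow> nat set \<Rightarrow> outcome" where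
  "weigh t A B =
     (if sum (excess t) A < sum (excess t) B then Left_Lighter
      else if sum (excess t) B < sum (excess t) A then Right_Lighter
      else Balance)"

definition weighing :: "nat set \<Rightarrow> nat set \<Rightarrow> nat set \<Rightarrow> bool" where
  "weighing coins A B \<longleftrightarrow> A \<subseteq> coins \<and> B \<subseteq> coins \<and> A \<inter> B = {} \<and> card A = card B"

definition update :: "possibility \<Rightarrow> nat set \<Rightarrow> nat set \<Rightarrow> possibility set \<Rightarrow> possibility set" where
  "update t A B S = {s \<in> S. weigh s A B = weigh t A B}"

lemma sum_excess:
  assumes "finite A"
  shows "sum (excess t) A = (if fst t \<in> A then excess t (fst t) else 0)"
proof -
  have "sum (excess t) A = (\<Sum>x\<in>A. if x = fst t then excess t (fst t) else 0)"
    by (rule sum.cong) (auto simp: excess_def)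
  then show ?thesis using assms by simp
qed

lemma weigh_eq:
  assumes "finite A" "finite B" "A \<inter> B = {}"
  shows "weigh (x, k) A B =
    (if x \<in> A then (case k of Lighter \<Rightarrow> Left_Lighter | Heavier \<Rightarrow> Right_Lighter)
     else if x \<in> B then (case k of Lighter \<Rightarrow> Right_Lighter | Heavier \<Rightarrow> Left_Lighter)
     else Balance)"
  using assms by (auto simp: weigh_def sum_excess excess_def split: kind.splits)

text \<open>The unknown coins are \<open>1, \<dots>, N\<close>; coin \<open>0\<close> is the extra coin known to be real.\<close>

definition all_coins :: "nat \<Rightarrow> nat set" where
  "all_coins N = {0..N}"

definition possibilities :: "nat \<Rightarrow> possibility set" where
  "possibilities N = {1..N} \<times> UNIV"

definition found :: "possibility set \<Rightarrow> bool" where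
  "found S \<longleftrightarrow> (\<exists>x. fst ` S = {x})"

definition identified :: "possibility set \<Rightarrow> bool" where
  "identified S \<longleftrightarrow> (\<exists>x k. S = {(x, k)})"

text \<open>The truth \<open>t\<close> is known to the players, not to the Observer. It stays fixed during play and
  determines the outcome of every weighing. A position is the set of possibilities consistent
  with all outcomes seen so far.\<close>

definition coin_game ::
    "(possibility set \<Rightarrow> bool) \<Rightarrow> convention \<Rightarrow> nat \<Rightarrow> possibility \<Rightarrow> possibility set game" where
  "coin_game goal c N t =
     \<lparr>start = possibilities N,
      move = (\<lambda>S S'. \<not> goal S \<and>
                (\<exists>A B. weighing (all_coins N) A B \<and> S' = update t A B S \<and> S' \<subset> S)),
      over = goal,
      play = c\<rparr>"

definition F_plus :: "nat \<Rightarrow> possibility \<Rightarrow> possibility set game" where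
  "F_plus = coin_game found Normal"

definition FI_plus :: "nat \<Rightarrow> possibility \<Rightarrow> possibility set game" where
  "FI_plus = coin_game identified Normal"

definition FM_plus :: "nat \<Rightarrow> possibility \<Rightarrow> possibility set game" where
  "FM_plus = coin_game found Misere"

definition FIM_plus :: "nat \<Rightarrow> possibility \<Rightarrow> possibility set game" where
  "FIM_plus = coin_game identified Misere"

end

theory Submission imports Defs begin

text \<open>From the start position, a reachable position is of one of two forms. Either no weighing was
  unbalanced and it is \<open>U \<times> UNIV\<close> for a set \<open>U\<close> of unknown coins, or some weighing was unbalanced
  and every remaining coin carries a single destiny, that is, \<^const>\<open>fst\<close> is injective on the position.
  Assign pile size \<open>card U\<close> to the former and \<open>card S - 1\<close> to a position \<open>S\<close> of the latter form
  (and \<open>0\<close> whenever the goal is reached).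

  Since the extra real coin can even out the pans, any set \<open>J\<close> of unknown coins can be the set of
  unknown coins on the scale (\<open>exists_weighing\<close>). Among destined coins, weighing a set of coins that
  are all real excludes exactly these, so every smaller positive number of destined coins can be
  left. Among the unknown coins \<open>U\<close>, weighing \<open>J \<subseteq> U\<close> with the counterfeit coin in \<open>J\<close> leaves \<open>card J\<close> destined
  coins, which gives all pile sizes \<open>0, \<dots>, card U - 1\<close>; a balanced weighing only leads to a smaller
  number of unknown coins. The goals of finding and of identifying the counterfeit coin differ only
  at the position with a single unknown coin, whose pile size is then \<open>0\<close> or \<open>1\<close>. Neither value
  affects the argument, so both goals are treated together.\<close>

section \<open>Weighings and their outcomes\<close>

lemma exists_weighing:
  assumes "J \<subseteq> {1..N}"
  obtains A B where "weighing (all_coins N) A B" "(A \<union> B) - {0} = J"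
proof -
  \<comment> \<open>The real coin \<open>0\<close> joins when needed to make the number of coins on the scale even.\<close>
  define K where "K = (if even (card J) then J else insert 0 J)"
  have fin: "finite J" and zero: "0 \<notin> J"
    using assms finite_subset by auto
  then have "finite K" "even (card K)" by (auto simp: K_def)
  moreover obtain A where A: "A \<subseteq> K" "card A = card K div 2"
    by (meson div_le_dividend obtain_subset_with_card_n)
  ultimately have "card (K - A) = card A"
    by (simp add: card_Diff_subset finite_subset) presburger
  moreover have "K \<subseteq> all_coins N"
    using assms by (auto simp: K_def all_coins_def)
  ultimately have "weighing (all_coins N) A (K - A)"
    using A by (auto simp: weighing_def)
  moreover have "K - {0} = J"
    using zero by (auto simp: K_def)
  then have "(A \<union> (K - A)) - {0} = J"
    using A(1) by blast
  ultimately show ?thesis by (rule that)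
qed

lemma weighing_pans:
  assumes "weighing (all_coins N) A B"
  shows "finite A" "finite B" "A \<inter> B = {}"
  using assms finite_subset by (auto simp: weighing_def all_coins_def)

lemma update_balanced:
  assumes "weighing (all_coins N) A B" "fst t \<notin> A \<union> B"
  shows "update t A B S = {s \<in> S. fst s \<notin> A \<union> B}"
  using assms(2) unfolding update_def
  by (cases t) (auto simp: weigh_eq[OF weighing_pans[OF assms(1)]] split: kind.splits if_splits)

text \<open>After an unbalanced weighing, a coin on the pan of the counterfeit coin is destined to deviate
  as the counterfeit coin does, and a coin on the other pan to deviate in the opposite way.\<close>

lemma update_unbalanced:
  assumes "weighing (all_coins N) A B" "fst t \<in> A \<union> B"
  shows "update t A B S =
    {s \<in> S. fst s \<in> A \<union> B \<and> (snd s = snd t \<longleftrightarrow> (fst s \<in> A \<longleftrightarrow> fst t \<in> A))}"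
proof -
  note pans = weighing_pans[OF assms(1)]
  have "weigh s A B = weigh t A B \<longleftrightarrow>
      fst s \<in> A \<union> B \<and> (snd s = snd t \<longleftrightarrow> (fst s \<in> A \<longleftrightarrow> fst t \<in> A))" for s
    using assms(2) pans(3)
    by (cases s; cases t; cases "snd s"; cases "snd t") (auto simp: weigh_eq[OF pans])
  then show ?thesis by (auto simp: update_def)
qed

lemma inj_on_update_unbalanced:
  assumes "weighing (all_coins N) A B" "fst t \<in> A \<union> B"
  shows "inj_on fst (update t A B S)"
proof (rule inj_onI)
  fix s s'
  assume s: "s \<in> update t A B S" "s' \<in> update t A B S" "fst s = fst s'"
  then have "snd s = snd t \<longleftrightarrow> snd s' = snd t"
    by (auto simp: update_unbalanced[OF assms])
  then have "snd s = snd s'"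
    by (cases "snd s"; cases "snd s'"; cases "snd t") auto
  then show "s = s'" using s(3) by (simp add: prod_eq_iff)
qed

section \<open>Reachable positions\<close>

text \<open>Either all coins of the position are unknown, or all of them are destined.\<close>

definition unknown_or_destined :: "nat \<Rightarrow> possibility \<Rightarrow> possibility set \<Rightarrow> bool" where
  "unknown_or_destined N t S \<longleftrightarrow>
     t \<in> S \<and> S \<subseteq> possibilities N \<and> (S = fst ` S \<times> UNIV \<or> inj_on fst S)"

lemma unknown_or_destined_start:
  "t \<in> possibilities N \<Longrightarrow> unknown_or_destined N t (possibilities N)"
  by (force simp: unknown_or_destined_def possibilities_def)

lemma unknown_or_destined_update:
  assumes "unknown_or_destined N t S" "weighing (all_coins N) A B"
  shows "unknown_or_destined N t (update t A B S)"
proof -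
  let ?S = "update t A B S"
  have sub: "t \<in> ?S" "?S \<subseteq> S" using assms(1) by (auto simp: update_def unknown_or_destined_def)
  moreover have "?S = fst ` ?S \<times> UNIV \<or> inj_on fst ?S"
  proof (cases "inj_on fst S \<or> fst t \<in> A \<union> B")
    case True
    then show ?thesis
      using inj_on_subset[OF _ sub(2)] inj_on_update_unbalanced[OF assms(2)] by blast
  next
    case False
    then have "S = fst ` S \<times> UNIV" using assms(1) by (auto simp: unknown_or_destined_def)
    moreover have "?S = {s \<in> S. fst s \<notin> A \<union> B}"
      using False update_balanced[OF assms(2)] by blast
    ultimately have "?S = (fst ` S - (A \<union> B)) \<times> UNIV" by auto
    then show ?thesis by auto
  qed
  ultimately show ?thesis using assms(1) by (auto simp: unknown_or_destined_def)
qed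

section \<open>Pile sizes\<close>

text \<open>The pile size of a position of either form. For the two goals of interest, the clause for
  \<open>goal S\<close> matters only at a single unknown coin: a single destined coin has size
  \<open>card S - 1 = 0\<close> anyway.\<close>

definition pile_size :: "(possibility set \<Rightarrow> bool) \<Rightarrow> possibility set \<Rightarrow> nat" where
  "pile_size goal S =
     (if goal S then 0 else if inj_on fst S then card S - 1 else card (fst ` S))"

lemma not_inj_on_fst_Times_UNIV:
  assumes "U \<noteq> {}"
  shows "\<not> inj_on fst (U \<times> (UNIV :: kind set))"
proof
  assume inj: "inj_on fst (U \<times> (UNIV :: kind set))"
  from assms obtain x where "x \<in> U" by blast
  then have "(x, Lighter) = (x, Heavier)" by (intro inj_onD[OF inj]) auto
  then show False by simp
qed

lemma finite_possibilities: "S \<subseteq> possibilities N \<Longrightarrow> finite S"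
proof -
  have "(UNIV :: kind set) = {Lighter, Heavier}" using kind.exhaust by blast
  then have "finite (UNIV :: kind set)" by (metis finite.simps)
  then show "S \<subseteq> possibilities N \<Longrightarrow> finite S"
    by (auto simp: possibilities_def intro: finite_subset)
qed

text \<open>The goal is constrained only on destined coins and at the start, so that the result covers
  both finding and identifying the counterfeit coin.\<close>

lemma coin_game_equivalent_to_nim:
  assumes t: "t \<in> possibilities N"
    and goal_destined: "\<And>S. inj_on fst S \<Longrightarrow> goal S \<longleftrightarrow> card S = 1"
    and not_goal_start: "\<not> goal (possibilities N)"
  shows "equivalent_to_nim (coin_game goal c N t) c N"
proof -
  let ?G = "coin_game goal c N t"
  let ?size = "pile_size goal"
  have reach: "unknown_or_destined N t S" if "reachable ?G S" for S
  proof -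
    have "(move ?G)\<^sup>*\<^sup>* (possibilities N) S"
      using that by (simp add: reachable_def coin_game_def)
    then show ?thesis
      by induction (auto simp: coin_game_def unknown_or_destined_update unknown_or_destined_start t)
  qed
  have size_destined: "?size S = card S - 1" if "inj_on fst S" for S
    using that goal_destined[OF that] by (auto simp: pile_size_def)
  have size_unknown: "?size S = card (fst ` S)" if "\<not> goal S" "\<not> inj_on fst S" for S
    using that by (simp add: pile_size_def)
  have start: "?size (possibilities N) = N"
  proof -
    have "{1..N} \<noteq> {}" using t by (auto simp: possibilities_def)
    then have "\<not> inj_on fst (possibilities N)"
      unfolding possibilities_def by (rule not_inj_on_fst_Times_UNIV)
    then show ?thesis using size_unknown[OF not_goal_start] by (simp add: possibilities_def)
  qed
  have over: "goal S \<longleftrightarrow> ?size S = 0" if "unknown_or_destined N t S" for S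
  proof -
    have S: "finite S" "t \<in> S"
      using that finite_possibilities by (auto simp: unknown_or_destined_def)
    then have "card S > 0" "card (fst ` S) > 0" by (auto simp: card_gt_0_iff)
    then show ?thesis using goal_destined[of S] by (auto simp: pile_size_def)
  qed
  have moves: "?size ` {S'. move ?G S S'} = {..<?size S}" if valid: "unknown_or_destined N t S" for S
  proof (cases "goal S")
    case True
    then show ?thesis by (simp add: coin_game_def pile_size_def)
  next
    case False
    have tS: "t \<in> S" and SN: "S \<subseteq> possibilities N" and fin: "finite S"
      using valid finite_possibilities by (auto simp: unknown_or_destined_def)
    have coins: "fst ` S \<subseteq> {1..N}" using SN by (auto simp: possibilities_def)
    have zero: "fst s \<noteq> 0" if "s \<in> S" for s using coins that by fastforce
    have moveI: "update t A B S \<in> {S'. move ?G S S'}"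
      if "weighing (all_coins N) A B" "update t A B S \<noteq> S" for A B
      using that False by (auto simp: coin_game_def update_def)
    show ?thesis
    proof (cases "inj_on fst S")
      case inj: True
      have "?size S' < ?size S" if "move ?G S S'" for S'
      proof -
        from that have S': "S' \<subset> S" "t \<in> S'"
          using tS by (auto simp: coin_game_def update_def)
        then have "card S' < card S" "card S' > 0"
          using fin by (auto simp: psubset_card_mono card_gt_0_iff intro: finite_subset)
        then show ?thesis
          using size_destined inj inj_on_subset[OF inj] S'(1) by auto
      qed
      moreover have "m \<in> ?size ` {S'. move ?G S S'}" if m: "m < ?size S" for m
      proof -
        have card_S: "m + 1 < card S" using m size_destined[OF inj] by simp
        have "card S - (m + 1) \<le> card (S - {t})" using tS by simp
        \<comment> \<open>The \<open>m + 1\<close> possibilities that are to remain are those outside \<open>R\<close>.\<close>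
        then obtain R where R: "R \<subseteq> S - {t}" "card R = card S - (m + 1)"
          using obtain_subset_with_card_n by metis
        have RS: "R \<subseteq> S" using R by blast
        have "fst ` R \<subseteq> {1..N}" using image_mono[OF RS] coins by (rule subset_trans)
        then obtain A B where w: "weighing (all_coins N) A B" and AB: "(A \<union> B) - {0} = fst ` R"
          by (rule exists_weighing)
        have on_scale: "fst s \<in> A \<union> B \<longleftrightarrow> s \<in> R" if "s \<in> S" for s
        proof -
          have "fst s \<in> A \<union> B \<longleftrightarrow> fst s \<in> fst ` R"
            unfolding AB[symmetric] using zero[OF that] by simp
          also have "\<dots> \<longleftrightarrow> s \<in> R" using inj_on_image_mem_iff[OF inj that RS] .
          finally show ?thesis .
        qed
        have "fst t \<notin> A \<union> B" using on_scale[OF tS] R by blast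
        from update_balanced[OF w this, of S] have upd: "update t A B S = S - R"
          using on_scale by auto
        have card_upd: "card (S - R) = m + 1"
          using R(2) RS fin card_S by (simp add: card_Diff_subset finite_subset)
        then have "update t A B S \<noteq> S" using upd card_S by auto
        moreover have "?size (S - R) = m"
          using size_destined[of "S - R"] inj card_upd by (simp add: inj_on_diff)
        ultimately show ?thesis using moveI[OF w] upd by (metis imageI)
      qed
      ultimately show ?thesis by auto
    next
      case not_inj: False
      define U where "U = fst ` S"
      have SU: "S = U \<times> UNIV" using valid not_inj by (auto simp: unknown_or_destined_def U_def)
      have finU: "finite U" using fin by (simp add: U_def)
      have size_S: "?size S = card U" using size_unknown[OF False not_inj] by (simp add: U_def)
      have tU: "fst t \<in> U" using tS by (simp add: U_def)
      have "?size S' < ?size S" if "move ?G S S'" for S'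
      proof -
        from that obtain A B where w: "weighing (all_coins N) A B"
          and upd: "S' = update t A B S" and S': "S' \<subset> S"
          by (auto simp: coin_game_def)
        have valid': "unknown_or_destined N t S'"
          using unknown_or_destined_update[OF valid w] upd by simp
        have sub: "fst ` S' \<subseteq> U" using S' by (auto simp: U_def)
        have pos: "card U > 0" using tU finU by (auto simp: card_gt_0_iff)
        show ?thesis
        proof (cases "inj_on fst S'")
          case True
          then have "card S' \<le> card U"
            using card_mono[OF finU sub] by (simp add: card_image)
          then show ?thesis using size_destined[OF True] size_S pos by linarith
        next
          case False
          then have "S' = fst ` S' \<times> UNIV" using valid' by (simp add: unknown_or_destined_def)
          then have "fst ` S' \<noteq> U" using S' SU by auto
          then have "card (fst ` S') < card U" using sub finU by (simp add: psubset_card_mono psubsetI)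
          then show ?thesis using False size_S by (auto simp: pile_size_def)
        qed
      qed
      moreover have "m \<in> ?size ` {S'. move ?G S S'}" if m: "m < ?size S" for m
      proof -
        \<comment> \<open>The counterfeit coin and \<open>m\<close> other unknown coins are weighed.\<close>
        have "m \<le> card (U - {fst t})" using m size_S tU by simp
        then obtain R where R: "R \<subseteq> U - {fst t}" "card R = m"
          using obtain_subset_with_card_n by metis
        define J where "J = insert (fst t) R"
        have J: "J \<subseteq> U" "fst t \<in> J" using R tU by (auto simp: J_def)
        have "finite R" "fst t \<notin> R" using R finU by (auto intro: finite_subset)
        then have cardJ: "card J = m + 1" using R(2) by (simp add: J_def)
        have "J \<subseteq> {1..N}" using J(1) coins unfolding U_def by (rule subset_trans)
        then obtain A B where w: "weighing (all_coins N) A B" and AB: "(A \<union> B) - {0} = J"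
          by (rule exists_weighing)
        have tAB: "fst t \<in> A \<union> B" using J(2) by (simp flip: AB)
        let ?S = "update t A B S"
        note inj = inj_on_update_unbalanced[OF w tAB, of S]
        have "fst ` ?S = J"
        proof
          show "fst ` ?S \<subseteq> J"
          proof
            fix y assume "y \<in> fst ` ?S"
            then obtain s where "s \<in> ?S" and y: "y = fst s" by blast
            then have "s \<in> S" "fst s \<in> A \<union> B" by (simp_all add: update_unbalanced[OF w tAB])
            then show "y \<in> J" using zero y by (simp flip: AB)
          qed
        next
          show "J \<subseteq> fst ` ?S"
          proof
            fix y assume y: "y \<in> J"
            have "\<exists>k. k = snd t \<longleftrightarrow> (y \<in> A \<longleftrightarrow> fst t \<in> A)"
              by (cases "snd t") (metis kind.distinct(1))+
            then obtain k where "k = snd t \<longleftrightarrow> (y \<in> A \<longleftrightarrow> fst t \<in> A)" by blast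
            moreover have "y \<in> A \<union> B" using y by (simp flip: AB)
            moreover have "(y, k) \<in> S" using y J(1) SU by auto
            ultimately have "(y, k) \<in> ?S" by (simp add: update_unbalanced[OF w tAB])
            then show "y \<in> fst ` ?S" by force
          qed
        qed
        then have "card ?S = m + 1" using card_image[OF inj] cardJ by simp
        then have "?size ?S = m" using size_destined[OF inj] by simp
        moreover have "?S \<noteq> S" using inj not_inj by auto
        ultimately show ?thesis using moveI[OF w] by (metis imageI)
      qed
      ultimately show ?thesis by auto
    qed
  qed
  show ?thesis
    unfolding equivalent_to_nim_iff
    using start over moves reach by (intro conjI exI[of _ ?size]) (auto simp: coin_game_def)
qed

section \<open>The two goals\<close>

lemma found_destined_iff: "inj_on fst S \<Longrightarrow> found S \<longleftrightarrow> card S = 1"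
  unfolding found_def by (metis card_1_singleton_iff card_image One_nat_def)

lemma identified_iff: "identified S \<longleftrightarrow> card S = 1"
  by (auto simp: identified_def card_1_singleton_iff)

lemma not_found_possibilities:
  assumes "N > 1"
  shows "\<not> found (possibilities N)"
proof
  assume "found (possibilities N)"
  then obtain x where "{1..N} = {x}" by (auto simp: found_def possibilities_def)
  then have "1 \<in> {x}" "2 \<in> {x}" using assms by auto
  then show False by simp
qed

theorem lemma6:
  fixes N :: nat and t :: possibility
  assumes "N > 1" and "t \<in> possibilities N"
  shows "equivalent_to_nim (F_plus N t) Normal N
       \<and> equivalent_to_nim (FI_plus N t) Normal N
       \<and> equivalent_to_nim (FM_plus N t) Misere N
       \<and> equivalent_to_nim (FIM_plus N t) Misere N"
proof -
  have "\<not> identified (possibilities N)"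
    using not_found_possibilities[OF assms(1)] by (auto simp: identified_def found_def)
  then have "equivalent_to_nim (coin_game identified c N t) c N" for c
    using assms(2) identified_iff by (intro coin_game_equivalent_to_nim)
  moreover have "equivalent_to_nim (coin_game found c N t) c N" for c
    using assms(2) found_destined_iff not_found_possibilities[OF assms(1)]
    by (intro coin_game_equivalent_to_nim)
  ultimately show ?thesis
    by (simp add: F_plus_def FI_plus_def FM_plus_def FIM_plus_def)
qed

end
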